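(* Let $\mathcal{X}$ be a non-empty finite set and let $X_1,\dots,X_n,\dots$ be an exchangeable sequence of random variables in $\mathcal{X}$, with time consistent family of exchangeable coherent lower previsions $\underline{P}^n$ on $\mathcal{L}(\mathcal{X}^n)$, $n\geq1$, and representing coherent lower prevision $\underline{R}$ on $\mathcal{C}(\Sigma)$. Let $f$ be any gamble on $\mathcal{X}$, and for $n\geq1$ let $\underline{P}_{S_n(f)}$ be the distribution of the sample mean $S_n(f)(X_1,\dots,X_n):=\frac1n\sum_{k=1}^nf(X_k)$. Then for all continuous gambles $h$ on $[\inf f,\sup f]$, $$\lim_{n\to\infty}\underline{P}_{S_n(f)}(h)=\underline{R}\big(h(S(f|\cdot))\big).$$ Thus, for an exchangeable sequence $X_1,\dots,X_n,\dots$, the sequence of sample means $S_n(f)(X_1,\dots,X_n)$ converges in distribution.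
   Context: A gamble on a non-empty set $\mathcal{Z}$ is a bounded map $\mathcal{Z}\to\mathbb{R}$; $\mathcal{L}(\mathcal{Z})$ is the linear space of all gambles on $\mathcal{Z}$. A lower prevision on a set of gambles is a real-valued functional on it. A lower prevision $\underline{P}$ on a linear space of gambles $\mathcal{K}$ is coherent iff for all $f,g\in\mathcal{K}$ and real $\lambda\geq0$: $\underline{P}(f)\geq\inf f$; $\underline{P}(\lambda f)=\lambda\underline{P}(f)$; $\underline{P}(f+g)\geq\underline{P}(f)+\underline{P}(g)$. A coherent lower prevision $\underline{P}^n$ on $\mathcal{L}(\mathcal{X}^n)$ is exchangeable if $\underline{P}^n(\pi f-f)\geq0$ for all gambles $f$ on $\mathcal{X}^n$ and all permutations $\pi$ of $\{1,\dots,n\}$, where $(\pi f)(x_1,\dots,x_n):=f(x_{\pi(1)},\dots,x_{\pi(n)})$. The beliefs about an exchangeable sequence $X_1,X_2,\dots$ in $\mathcal{X}$ are described by a family of exchangeable coherent lower previsions $\underline{P}^n$ on $\mathcal{L}(\mathcal{X}^n)$ (the joint distributions of $X_1,\dots,X_n$), $n\geq1$, that is time consistent: $\underline{P}^n(f)=\underline{P}^{n+k}(\tilde f)$ for all $n\geq1$, $k\geq0$ and all gambles $f$ on $\mathcal{X}^n$, where $\tilde f(z_1,\dots,z_{n+k}):=f(z_1,\dots,z_n)$. $\Sigma:=\{\theta\in\mathbb{R}^{\mathcal{X}}:\theta_x\geq0\text{ for all }x,\ \sum_{x\in\mathcal{X}}\theta_x=1\}$ is the $\mathcal{X}$-simplex;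 $\mathcal{V}(\Sigma)$ is the linear space of all polynomial functions on $\Sigma$ and $\mathcal{C}(\Sigma)$ that of all continuous functions on $\Sigma$. For $f\in\mathcal{L}(\mathcal{X}^n)$ and $\theta\in\Sigma$, $\mathrm{Mn}^n(f|\theta):=\sum_{\mathbf{z}\in\mathcal{X}^n}f(\mathbf{z})\prod_{k=1}^n\theta_{z_k}$. The representing lower prevision $\underline{R}$ of the family is the unique coherent lower prevision on $\mathcal{V}(\Sigma)$ such that $\underline{P}^n(f)=\underline{R}(\mathrm{Mn}^n(f|\cdot))$ for all $n\geq1$ and $f\in\mathcal{L}(\mathcal{X}^n)$; it has a unique extension to a coherent lower prevision on $\mathcal{C}(\Sigma)$ (polynomials being uniformly dense and coherent lower previsions being continuous under uniform convergence), also denoted $\underline{R}$. For $f\in\mathcal{L}(\mathcal{X})$ and $\theta\in\Sigma$, $S(f|\theta):=\sum_{x\in\mathcal{X}}f(x)\theta_x$, and $h(S(f|\cdot))$ is the map $\theta\mapsto h(S(f|\theta))$. The distribution of $S_n(f)$ is the coherent lower prevision on $\mathcal{L}([\inf f,\sup f])$ given by $\underline{P}_{S_n(f)}(h):=\underline{P}^n(h\circ S_n(f))$, where $S_n(f)(\mathbf{z}):=\frac1n\sum_{k=1}^nf(z_k)$ for $\mathbf{z}\in\mathcal{X}^n$. A sequence of random variables with values in a metric space $S$ and distributions $\underline{P}_n$ on $\mathcal{L}(S)$ converges in distribution if for every continuous gamble $h$ on $S$ the real sequence $\underline{P}_n(h)$ converges to a real number. *)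

theory Defs
  imports "HOL-Analysis.Analysis"
begin

(* A gamble on Z is a function on the whole type; only its values on Z count. A functional on
   such functions need not respect equality on Z by itself, but a coherent one does: see
   coherent_lower_prevision_cong below. *)
definition gambles :: "'z set \<Rightarrow> ('z \<Rightarrow> real) set" where
  "gambles Z = {f. bounded (f ` Z)}"

(* Meant for a linear space K of gambles on the non-empty set Z. *)
definition coherent_lower_prevision ::
    "'z set \<Rightarrow> ('z \<Rightarrow> real) set \<Rightarrow> (('z \<Rightarrow> real) \<Rightarrow> real) \<Rightarrow> bool" where
  "coherent_lower_prevision Z K P \<longleftrightarrow>
     (\<forall>f\<in>K. P f \<ge> (INF z\<in>Z. f z)) \<and>
     (\<forall>f\<in>K. \<forall>c\<ge>0. P (\<lambda>z. c * f z) = c * P f) \<and>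
     (\<forall>f\<in>K. \<forall>g\<in>K. P (\<lambda>z. f z + g z) \<ge> P f + P g)"

lemma coherent_lower_prevision_cong:
  assumes P: "coherent_lower_prevision Z K P" and "Z \<noteq> {}"
    and diff: "\<And>f g. f \<in> K \<Longrightarrow> g \<in> K \<Longrightarrow> (\<lambda>z. f z - g z) \<in> K"
    and K: "f \<in> K" "g \<in> K" and eq: "\<And>z. z \<in> Z \<Longrightarrow> f z = g z"
  shows "P f = P g"
proof -
  have le: "P v \<le> P u" if "u \<in> K" "v \<in> K" "\<And>z. z \<in> Z \<Longrightarrow> u z = v z" for u v
  proof -
    have "(\<lambda>z. u z - v z) ` Z = {0}"
      using that(3) \<open>Z \<noteq> {}\<close> by auto
    then have "(INF z\<in>Z. u z - v z) = 0" by simp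
    moreover have "(INF z\<in>Z. u z - v z) \<le> P (\<lambda>z. u z - v z)"
      using P diff[OF that(1,2)] unfolding coherent_lower_prevision_def by blast
    ultimately have "0 \<le> P (\<lambda>z. u z - v z)" by simp
    moreover have "P v + P (\<lambda>z. u z - v z) \<le> P (\<lambda>z. v z + (u z - v z))"
      using P diff[OF that(1,2)] that(2) unfolding coherent_lower_prevision_def by blast
    ultimately show ?thesis by simp
  qed
  show ?thesis using le[OF K eq] le[OF K(2,1) eq[symmetric]] by (rule antisym[rotated])
qed

(* The n-th power of the type 'x: tuples with entries z 1, ..., z n. *)
definition tuples :: "nat \<Rightarrow> (nat \<Rightarrow> 'x) set" where
  "tuples n = ({1..n} \<rightarrow>\<^sub>E UNIV)"

definition exchangeable :: "nat \<Rightarrow> (((nat \<Rightarrow> 'x) \<Rightarrow> real) \<Rightarrow> real) \<Rightarrow> bool" where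
  "exchangeable n P \<longleftrightarrow>
     (\<forall>f\<in>gambles (tuples n). \<forall>\<pi>. \<pi> permutes {1..n} \<longrightarrow> P (\<lambda>z. f (z \<circ> \<pi>) - f z) \<ge> 0)"

definition time_consistent :: "(nat \<Rightarrow> ((nat \<Rightarrow> 'x) \<Rightarrow> real) \<Rightarrow> real) \<Rightarrow> bool" where
  "time_consistent P \<longleftrightarrow>
     (\<forall>n\<ge>1. \<forall>k. \<forall>f\<in>gambles (tuples n). P n f = P (n + k) (\<lambda>z. f (restrict z {1..n})))"

(* P n is the joint distribution of the first n variables; P 0 is irrelevant. *)
definition exchangeable_sequence :: "(nat \<Rightarrow> ((nat \<Rightarrow> 'x) \<Rightarrow> real) \<Rightarrow> real) \<Rightarrow> bool" where
  "exchangeable_sequence P \<longleftrightarrow>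
     (\<forall>n\<ge>1. coherent_lower_prevision (tuples n) (gambles (tuples n)) (P n) \<and>
            exchangeable n (P n)) \<and>
     time_consistent P"

definition X_simplex :: "(real ^ 'x) set" where
  "X_simplex = {\<theta>. (\<forall>x. \<theta> $ x \<ge> 0) \<and> (\<Sum>x\<in>UNIV. \<theta> $ x) = 1}"

definition polynomials_on_simplex :: "(real ^ 'x \<Rightarrow> real) set" where
  "polynomials_on_simplex =
     {g. \<exists>p. real_polynomial_function p \<and> (\<forall>\<theta>\<in>X_simplex. g \<theta> = p \<theta>)}"

definition continuous_on_simplex :: "(real ^ 'x \<Rightarrow> real) set" where
  "continuous_on_simplex = {g. continuous_on X_simplex g}"

definition Mn :: "nat \<Rightarrow> ((nat \<Rightarrow> 'x) \<Rightarrow> real) \<Rightarrow> real ^ 'x \<Rightarrow> real" where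
  "Mn n f \<theta> = (\<Sum>z\<in>tuples n. f z * (\<Prod>k=1..n. \<theta> $ z k))"

(* R stands both for the representing lower prevision on the polynomials and for its coherent
   extension to the continuous functions. *)
definition representing_lower_prevision ::
    "(nat \<Rightarrow> ((nat \<Rightarrow> 'x) \<Rightarrow> real) \<Rightarrow> real) \<Rightarrow> ((real ^ 'x \<Rightarrow> real) \<Rightarrow> real) \<Rightarrow> bool" where
  "representing_lower_prevision P R \<longleftrightarrow>
     coherent_lower_prevision X_simplex polynomials_on_simplex R \<and>
     (\<forall>n\<ge>1. \<forall>f\<in>gambles (tuples n). P n f = R (Mn n f)) \<and>
     coherent_lower_prevision X_simplex continuous_on_simplex R"

definition S :: "('x \<Rightarrow> real) \<Rightarrow> real ^ 'x \<Rightarrow> real" where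
  "S f \<theta> = (\<Sum>x\<in>UNIV. f x * \<theta> $ x)"

definition sample_mean :: "nat \<Rightarrow> ('x \<Rightarrow> real) \<Rightarrow> (nat \<Rightarrow> 'x) \<Rightarrow> real" where
  "sample_mean n f z = (1 / real n) * (\<Sum>k=1..n. f (z k))"

definition sample_mean_distribution ::
    "(nat \<Rightarrow> ((nat \<Rightarrow> 'x) \<Rightarrow> real) \<Rightarrow> real) \<Rightarrow> ('x \<Rightarrow> real) \<Rightarrow> nat \<Rightarrow> (real \<Rightarrow> real) \<Rightarrow> real" where
  "sample_mean_distribution P f n h = P n (h \<circ> sample_mean n f)"

definition converges_in_distribution ::
    "'a::metric_space set \<Rightarrow> (nat \<Rightarrow> ('a \<Rightarrow> real) \<Rightarrow> real) \<Rightarrow> bool" where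
  "converges_in_distribution T Q \<longleftrightarrow>
     (\<forall>h\<in>gambles T. continuous_on T h \<longrightarrow> convergent (\<lambda>n. Q n h))"

end

theory Submission
  imports Defs
begin

text \<open>
  Both claims come from one form of the weak law of large numbers. If finitely many samples in
  \<open>[a, b]\<close> share the mean \<open>\<mu>\<close> and are pairwise not positively correlated, then the variance of
  their average is at most \<open>(b - a)\<^sup>2 / n\<close>, and Bernstein's argument bounds the distance
  between the expectation of \<open>h\<close> of the average and \<open>h \<mu>\<close> by a quantity that depends only on
  \<open>n\<close>, \<open>h\<close>, \<open>a\<close> and \<open>b\<close> (\<open>weak_law_uniform\<close>).

  Under multinomial sampling with parameter \<open>\<theta>\<close> the samples are uncorrelated with mean \<open>S f \<theta>\<close>,
  so the polynomials \<open>Mn n (h \<circ> sample_mean n f)\<close> converge to \<open>h (S f \<theta>)\<close> uniformly on the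
  simplex (\<open>Mn_sample_mean_uniform\<close>). A coherent lower prevision is 1-Lipschitz for the supremum
  norm, hence \<open>R\<close> preserves this limit.

  Convergence in distribution is proved without a representing lower prevision. For \<open>n \<le> N\<close>, time
  consistency turns the prevision of \<open>h\<close> of the \<open>n\<close>-th mean into one under \<open>P N\<close>, and
  exchangeability allows the gamble to be replaced by its average over all permutations
  (\<open>exchangeable_average\<close>). That average describes drawing \<open>n\<close> of the \<open>N\<close> values without
  replacement, where distinct draws are not positively correlated and have the \<open>N\<close>-th mean as their
  expectation. The weak law then bounds the distance to \<open>h\<close> of the \<open>N\<close>-th mean
  (\<open>permutation_sample_mean_uniform\<close>), so the previsions form a Cauchy sequence.
\<close>

section \<open>A weak law for non-positively correlated samples\<close>

lemma variance_average_le: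
  fixes w :: "'a \<Rightarrow> real" and Y :: "nat \<Rightarrow> 'a \<Rightarrow> real"
  assumes "n \<ge> 1" and w: "\<And>z. z \<in> A \<Longrightarrow> w z \<ge> 0" "sum w A = 1"
    and Y: "\<And>k z. k \<in> {1..n} \<Longrightarrow> z \<in> A \<Longrightarrow> \<bar>Y k z\<bar> \<le> D"
    and corr: "\<And>k l. k \<in> {1..n} \<Longrightarrow> l \<in> {1..n} \<Longrightarrow> k \<noteq> l \<Longrightarrow> (\<Sum>z\<in>A. w z * (Y k z * Y l z)) \<le> 0"
  shows "(\<Sum>z\<in>A. w z * ((1 / real n) * (\<Sum>k=1..n. Y k z))\<^sup>2) \<le> D\<^sup>2 / real n"
proof -
  let ?c = "\<lambda>k l. \<Sum>z\<in>A. w z * (Y k z * Y l z)"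
  have diag: "?c k k \<le> D\<^sup>2" if "k \<in> {1..n}" for k
  proof -
    have "?c k k \<le> (\<Sum>z\<in>A. w z * D\<^sup>2)"
    proof (intro sum_mono mult_left_mono w(1))
      fix z assume "z \<in> A"
      from Y[OF that this] show "Y k z * Y k z \<le> D\<^sup>2"
        by (metis abs_ge_zero power2_abs power2_eq_square power_mono)
    qed
    also have "\<dots> = D\<^sup>2" using w(2) by (simp flip: sum_distrib_right)
    finally show ?thesis .
  qed
  have row: "(\<Sum>l=1..n. ?c k l) \<le> D\<^sup>2" if k: "k \<in> {1..n}" for k
  proof -
    have "(\<Sum>l=1..n. ?c k l) = ?c k k + (\<Sum>l\<in>{1..n} - {k}. ?c k l)"
      by (rule sum.remove) (use k in auto)
    moreover have "(\<Sum>l\<in>{1..n} - {k}. ?c k l) \<le> 0"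
      by (rule sum_nonpos) (use k corr in auto)
    ultimately show ?thesis using diag[OF k] by linarith
  qed
  have "(\<Sum>z\<in>A. w z * ((1 / real n) * (\<Sum>k=1..n. Y k z))\<^sup>2)
      = (1 / real n)\<^sup>2 * (\<Sum>z\<in>A. \<Sum>k=1..n. \<Sum>l=1..n. w z * (Y k z * Y l z))"
    unfolding sum_distrib_left
    by (simp add: power2_eq_square sum_product sum_distrib_left mult_ac)
  also have "(\<Sum>z\<in>A. \<Sum>k=1..n. \<Sum>l=1..n. w z * (Y k z * Y l z)) = (\<Sum>k=1..n. \<Sum>l=1..n. ?c k l)"
    by (subst sum.swap, rule sum.cong[OF refl], rule sum.swap)
  also have "(1 / real n)\<^sup>2 * \<dots> \<le> (1 / real n)\<^sup>2 * (\<Sum>k=1..n. D\<^sup>2)"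
    by (intro mult_left_mono sum_mono row) auto
  also have "\<dots> = D\<^sup>2 / real n"
    using \<open>n \<ge> 1\<close> by (simp add: power2_eq_square)
  finally show ?thesis .
qed

lemma average_in_interval:
  fixes y :: "nat \<Rightarrow> real"
  assumes "n \<ge> 1" "\<And>k. k \<in> {1..n} \<Longrightarrow> y k \<in> {a..b}"
  shows "(1 / real n) * (\<Sum>k=1..n. y k) \<in> {a..b}"
proof -
  have "(\<Sum>k=1..n. y k) \<le> (\<Sum>k=1..n. b)" "(\<Sum>k=1..n. a) \<le> (\<Sum>k=1..n. y k)"
    by (rule sum_mono; use assms(2) in simp)+
  then show ?thesis using assms(1) by (auto simp: field_simps)
qed

text \<open>
  The threshold \<open>n0\<close> is chosen before the probability weights, the samples and their mean; the
  two applications below depend on this uniformity in \<open>\<theta>\<close> and in the population, respectively.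
\<close>
lemma weak_law_uniform:
  fixes h :: "real \<Rightarrow> real"
  assumes h: "continuous_on {a..b} h" and "e > 0"
  obtains n0 where "n0 \<ge> 1"
    "\<And>n (A :: 'a set) w Y \<mu>. n \<ge> n0 \<Longrightarrow>
    (\<forall>z\<in>A. w z \<ge> 0) \<Longrightarrow> sum w A = 1 \<Longrightarrow> \<mu> \<in> {a..b} \<Longrightarrow>
    (\<forall>k\<in>{1..n}. \<forall>z\<in>A. Y k z \<in> {a..b}) \<Longrightarrow>
    (\<forall>k\<in>{1..n}. \<forall>l\<in>{1..n}. k \<noteq> l \<longrightarrow> (\<Sum>z\<in>A. w z * ((Y k z - \<mu>) * (Y l z - \<mu>))) \<le> 0) \<Longrightarrow>
    \<bar>(\<Sum>z\<in>A. w z * h ((1 / real n) * (\<Sum>k=1..n. Y k z))) - h \<mu>\<bar> \<le> e"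
proof -
  have "compact (h ` {a..b})"
    using h by (intro compact_continuous_image) auto
  then obtain M where M: "M > 0" "\<And>x. x \<in> {a..b} \<Longrightarrow> \<bar>h x\<bar> \<le> M"
    by (auto dest!: compact_imp_bounded simp: bounded_pos)
  have "uniformly_continuous_on {a..b} h"
    using h by (intro compact_uniformly_continuous) auto
  then obtain d where d: "d > 0"
    "\<And>x y. x \<in> {a..b} \<Longrightarrow> y \<in> {a..b} \<Longrightarrow> \<bar>y - x\<bar> < d \<Longrightarrow> \<bar>h y - h x\<bar> < e / 2"
    unfolding uniformly_continuous_on_def dist_real_def
    using half_gt_zero[OF \<open>e > 0\<close>] by blast
  define C where "C = 2 * M / d\<^sup>2"
  have "C > 0" using M(1) d(1) by (simp add: C_def)
  obtain m :: nat where m: "real m > 2 * C * (b - a)\<^sup>2 / e"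
    using reals_Archimedean2 by blast
  \<comment> \<open>Points close to the mean are controlled by uniform continuity; for the others the factor
     \<open>(y - \<mu>)\<^sup>2 / d\<^sup>2\<close> is at least 1 and absorbs the crude bound \<open>2 * M\<close>.\<close>
  have pt: "\<bar>h y - h \<mu>\<bar> \<le> e / 2 + C * (y - \<mu>)\<^sup>2" if y: "y \<in> {a..b}" "\<mu> \<in> {a..b}" for y \<mu>
  proof (cases "\<bar>y - \<mu>\<bar> < d")
    case True
    then have "\<bar>h y - h \<mu>\<bar> < e / 2" using d(2) y by blast
    moreover have "C * (y - \<mu>)\<^sup>2 \<ge> 0" using \<open>C > 0\<close> by simp
    ultimately show ?thesis by linarith
  next
    case False
    then have "d\<^sup>2 \<le> (y - \<mu>)\<^sup>2"
      using d(1) by (metis abs_le_square_iff abs_of_pos not_less)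
    then have "C * d\<^sup>2 \<le> C * (y - \<mu>)\<^sup>2" using \<open>C > 0\<close> by simp
    moreover have "C * d\<^sup>2 = 2 * M" using d(1) by (simp add: C_def)
    moreover have "\<bar>h y - h \<mu>\<bar> \<le> 2 * M" using M(2)[OF y(1)] M(2)[OF y(2)] by linarith
    ultimately show ?thesis using \<open>e > 0\<close> by linarith
  qed
  have "\<bar>(\<Sum>z\<in>A. w z * h ((1 / real n) * (\<Sum>k=1..n. Y k z))) - h \<mu>\<bar> \<le> e"
    if n: "n \<ge> Suc m" and w: "\<forall>z\<in>A. w z \<ge> 0" "sum w A = 1" and \<mu>: "\<mu> \<in> {a..b}"
      and Y: "\<forall>k\<in>{1..n}. \<forall>z\<in>A. Y k z \<in> {a..b}"
      and corr: "\<forall>k\<in>{1..n}. \<forall>l\<in>{1..n}. k \<noteq> l \<longrightarrow>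
        (\<Sum>z\<in>A. w z * ((Y k z - \<mu>) * (Y l z - \<mu>))) \<le> 0"
    for n and A :: "'a set" and w Y \<mu>
  proof -
    define T where "T z = (1 / real n) * (\<Sum>k=1..n. Y k z)" for z
    have n1: "n \<ge> 1" using n by simp
    have T: "T z \<in> {a..b}" if "z \<in> A" for z
      unfolding T_def using n1 by (rule average_in_interval) (use Y that in auto)
    have T_centred: "T z - \<mu> = (1 / real n) * (\<Sum>k=1..n. Y k z - \<mu>)" for z
      using n1 by (simp add: T_def sum_subtractf field_simps)
    have var: "(\<Sum>z\<in>A. w z * (T z - \<mu>)\<^sup>2) \<le> (b - a)\<^sup>2 / real n"
      unfolding T_centred
    proof (rule variance_average_le[OF n1])
      fix k z assume "k \<in> {1..n}" "z \<in> A"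
      then have "Y k z \<in> {a..b}" using Y by blast
      then show "\<bar>Y k z - \<mu>\<bar> \<le> b - a" using \<mu> by auto
    qed (use w corr in auto)
    have "(\<Sum>z\<in>A. w z * h (T z)) - h \<mu> = (\<Sum>z\<in>A. w z * (h (T z) - h \<mu>))"
      using w(2) by (simp add: right_diff_distrib sum_subtractf flip: sum_distrib_right)
    also have "\<bar>\<dots>\<bar> \<le> (\<Sum>z\<in>A. w z * (e / 2 + C * (T z - \<mu>)\<^sup>2))"
    proof (rule order_trans[OF sum_abs], rule sum_mono)
      fix z assume z: "z \<in> A"
      show "\<bar>w z * (h (T z) - h \<mu>)\<bar> \<le> w z * (e / 2 + C * (T z - \<mu>)\<^sup>2)"
        unfolding abs_mult using w(1) z pt[OF T[OF z] \<mu>] by (simp add: mult_left_mono)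
    qed
    also have "\<dots> = sum w A * (e / 2) + C * (\<Sum>z\<in>A. w z * (T z - \<mu>)\<^sup>2)"
      by (simp add: distrib_left sum.distrib sum_distrib_left sum_distrib_right mult_ac)
    also have "\<dots> \<le> e / 2 + C * ((b - a)\<^sup>2 / real n)"
      using mult_left_mono[OF var, of C] w(2) \<open>C > 0\<close> by simp
    also have "\<dots> \<le> e"
    proof -
      have "real n * e > 2 * C * (b - a)\<^sup>2"
      proof -
        have "2 * C * (b - a)\<^sup>2 < real m * e" using m \<open>e > 0\<close> by (simp add: field_simps)
        also have "\<dots> \<le> real n * e" using n \<open>e > 0\<close> by simp
        finally show ?thesis .
      qed
      then show ?thesis using n1 by (simp add: field_simps)
    qed
    finally show ?thesis unfolding T_def .
  qed
  then show thesis by (intro that[of "Suc m"]) simp_all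
qed

section \<open>Coherence and exchangeability\<close>

lemma coherent_lipschitz:
  assumes P: "coherent_lower_prevision Z K P" and "Z \<noteq> {}"
    and K: "u \<in> K" "v \<in> K" "(\<lambda>z. u z - v z) \<in> K" "(\<lambda>z. v z - u z) \<in> K"
    and e: "\<And>z. z \<in> Z \<Longrightarrow> \<bar>u z - v z\<bar> \<le> e"
  shows "\<bar>P u - P v\<bar> \<le> e"
proof -
  have le: "P q - P p \<le> e"
    if "p \<in> K" "q \<in> K" "(\<lambda>z. p z - q z) \<in> K" "\<And>z. z \<in> Z \<Longrightarrow> \<bar>p z - q z\<bar> \<le> e" for p q
  proof -
    have "- e \<le> (INF z\<in>Z. p z - q z)"
      using \<open>Z \<noteq> {}\<close> that(4) by (intro cINF_greatest) (fastforce simp: abs_le_iff)+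
    also have "\<dots> \<le> P (\<lambda>z. p z - q z)"
      using P that(3) unfolding coherent_lower_prevision_def by blast
    finally have "- e \<le> P (\<lambda>z. p z - q z)" .
    moreover have "P q + P (\<lambda>z. p z - q z) \<le> P (\<lambda>z. q z + (p z - q z))"
      using P that(2,3) unfolding coherent_lower_prevision_def by blast
    ultimately show ?thesis by simp
  qed
  show ?thesis
    using le[OF K(1,2,3) e] le[OF K(2,1,4)] e by (simp add: abs_minus_commute abs_le_iff)
qed

lemma finite_tuples: "finite (tuples n :: (nat \<Rightarrow> 'x::finite) set)"
  unfolding tuples_def by (intro finite_PiE) auto

lemma tuples_nonempty: "tuples n \<noteq> {}"
  unfolding tuples_def by (simp add: PiE_eq_empty_iff)

lemma gambles_tuples: "gambles (tuples n) = (UNIV :: ((nat \<Rightarrow> 'x::finite) \<Rightarrow> real) set)"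
  unfolding gambles_def by (simp add: finite_tuples finite_imp_bounded)

lemma coherent_sum_le:
  assumes P: "coherent_lower_prevision Z UNIV P" and "finite I"
  shows "(\<Sum>i\<in>I. P (u i)) \<le> P (\<lambda>z. \<Sum>i\<in>I. u i z)"
  using \<open>finite I\<close>
proof (induction I rule: finite_induct)
  case empty
  have "P (\<lambda>z. c * v z) = c * P v" if "c \<ge> 0" for c v
    using P that unfolding coherent_lower_prevision_def by blast
  from this[of 0 "\<lambda>_. 0"] have "P (\<lambda>z. 0) = 0" by simp
  then show ?case by simp
next
  case (insert i I)
  have "P (u i) + P (\<lambda>z. \<Sum>i\<in>I. u i z) \<le> P (\<lambda>z. u i z + (\<Sum>i\<in>I. u i z))"
    using P unfolding coherent_lower_prevision_def by blast
  then show ?case using insert by simp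
qed

text \<open>
  Exchangeability, applied to \<open>u\<close> and to \<open>- u\<close>, gives \<open>P (u \<circ> \<pi> - u) \<ge> 0\<close> and
  \<open>P (u - u \<circ> \<pi>) \<ge> 0\<close>; superadditivity keeps both inequalities for the mean over all \<open>\<pi>\<close>, and
  each of them compares \<open>P\<close> of the mean with \<open>P u\<close>.
\<close>
lemma exchangeable_average:
  fixes P :: "((nat \<Rightarrow> 'x::finite) \<Rightarrow> real) \<Rightarrow> real"
  assumes P: "coherent_lower_prevision Z UNIV P" and ex: "exchangeable n P"
  shows "P (\<lambda>z. \<Sum>\<pi> | \<pi> permutes {1..n}. (1 / fact n) * u (z \<circ> \<pi>)) = P u"
proof -
  let ?perms = "{\<pi>. \<pi> permutes {1..n}}"
  let ?avg = "\<lambda>z. \<Sum>\<pi>\<in>?perms. (1 / fact n) * u (z \<circ> \<pi>)"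
  have fin: "finite ?perms" by (simp add: finite_permutations)
  have card: "card ?perms = fact n" by (simp add: card_permutations)
  have super: "P u + P v \<le> P (\<lambda>z. u z + v z)" for u v
    using P unfolding coherent_lower_prevision_def by blast
  have pos: "0 \<le> P (\<lambda>z. \<Sum>\<pi>\<in>?perms. (1 / fact n) * (s * u (z \<circ> \<pi>) - s * u z))" for s
  proof -
    have "0 \<le> P (\<lambda>z. (1 / fact n) * (s * u (z \<circ> \<pi>) - s * u z))" if "\<pi> permutes {1..n}" for \<pi>
    proof -
      have "P (\<lambda>z. c * v z) = c * P v" if "c \<ge> 0" for c v
        using P that unfolding coherent_lower_prevision_def by blast
      from this[of "1 / fact n" "\<lambda>z. s * u (z \<circ> \<pi>) - s * u z"]
      have "P (\<lambda>z. (1 / fact n) * (s * u (z \<circ> \<pi>) - s * u z))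
          = (1 / fact n) * P (\<lambda>z. s * u (z \<circ> \<pi>) - s * u z)"
        by (simp only: zero_le_divide_1_iff fact_ge_zero)
      moreover have "0 \<le> P (\<lambda>z. s * u (z \<circ> \<pi>) - s * u z)"
        using bspec[OF ex[unfolded exchangeable_def gambles_tuples], of "\<lambda>z. s * u z"] that by simp
      ultimately show ?thesis by simp
    qed
    then have "0 \<le> (\<Sum>\<pi>\<in>?perms. P (\<lambda>z. (1 / fact n) * (s * u (z \<circ> \<pi>) - s * u z)))"
      by (intro sum_nonneg) simp
    also note coherent_sum_le[OF P fin]
    finally show ?thesis .
  qed
  have split: "(\<Sum>\<pi>\<in>?perms. (1 / fact n) * (s * u (z \<circ> \<pi>) - s * u z)) = s * ?avg z - s * u z" for s z
    by (simp add: right_diff_distrib sum_subtractf card[simplified] sum_distrib_left)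
  have "P u \<le> P ?avg"
    using pos[of 1] super[of u "\<lambda>z. ?avg z - u z"] unfolding split by simp
  moreover have "P ?avg \<le> P u"
    using pos[of "- 1"] super[of ?avg "\<lambda>z. u z - ?avg z"] unfolding split by simp
  ultimately show ?thesis by simp
qed

section \<open>Multinomial sampling\<close>

lemma f_in_range_interval: "f x \<in> {(INF x. f x)..(SUP x. f x)}" for f :: "'x::finite \<Rightarrow> real"
  by (auto intro!: cINF_lower cSUP_upper)

lemma S_in_range_interval:
  fixes f :: "'x::finite \<Rightarrow> real"
  assumes "\<theta> \<in> X_simplex"
  shows "S f \<theta> \<in> {(INF x. f x)..(SUP x. f x)}"
proof -
  have \<theta>: "\<theta> $ x \<ge> 0" "(\<Sum>x\<in>UNIV. \<theta> $ x) = 1" for x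
    using assms by (auto simp: X_simplex_def)
  have "S f \<theta> \<le> (\<Sum>x\<in>UNIV. (SUP x. f x) * \<theta> $ x)" "(\<Sum>x\<in>UNIV. (INF x. f x) * \<theta> $ x) \<le> S f \<theta>"
    unfolding S_def using f_in_range_interval[of f] \<theta>(1) by (auto intro!: sum_mono mult_right_mono)
  then show ?thesis using \<theta>(2) by (simp flip: sum_distrib_left)
qed

lemma sum_tuples_prod:
  fixes q :: "nat \<Rightarrow> 'x::finite \<Rightarrow> real"
  shows "(\<Sum>z\<in>tuples n. \<Prod>k=1..n. q k (z k)) = (\<Prod>k=1..n. \<Sum>x\<in>UNIV. q k x)"
  unfolding tuples_def by (rule prod_sum_PiE[symmetric]) auto

text \<open>
  Multiplying the product weight by \<open>g (z k) * g (z l)\<close> keeps it a product over the coordinates,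
  and its \<open>k\<close>-th factor sums to the mean of \<open>g\<close>.
\<close>
lemma tuples_uncorrelated:
  fixes \<theta> :: "real ^ 'x::finite"
  assumes kl: "k \<in> {1..n}" "l \<in> {1..n}" "k \<noteq> l" and g: "(\<Sum>x\<in>UNIV. \<theta> $ x * g x) = 0"
  shows "(\<Sum>z\<in>tuples n. (\<Prod>j=1..n. \<theta> $ z j) * (g (z k) * g (z l))) = 0"
proof -
  let ?q = "\<lambda>j x. \<theta> $ x * ((if j = k then g x else 1) * (if j = l then g x else 1))"
  have "(\<Sum>z\<in>tuples n. (\<Prod>j=1..n. \<theta> $ z j) * (g (z k) * g (z l)))
      = (\<Sum>z\<in>tuples n. \<Prod>j=1..n. ?q j (z j))"
    using kl by (simp add: prod.distrib)
  also have "\<dots> = (\<Prod>j=1..n. \<Sum>x\<in>UNIV. ?q j x)"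
    by (rule sum_tuples_prod)
  also have "\<dots> = 0"
    using kl g by (intro prod_zero bexI[of _ k]) auto
  finally show ?thesis .
qed

lemma Mn_sample_mean_uniform:
  fixes f :: "'x::finite \<Rightarrow> real"
    and h :: "real \<Rightarrow> real"
  assumes "continuous_on {(INF x. f x)..(SUP x. f x)} h" and "e > 0"
  shows "\<exists>n0\<ge>1. \<forall>n\<ge>n0. \<forall>\<theta>\<in>X_simplex. \<bar>Mn n (h \<circ> sample_mean n f) \<theta> - h (S f \<theta>)\<bar> \<le> e"
proof (rule weak_law_uniform[OF assms, where 'a = "nat \<Rightarrow> 'x"], goal_cases)
  case (1 n0)
  note n0 = 1(1) and law = 1(2)
  have "\<bar>Mn n (h \<circ> sample_mean n f) \<theta> - h (S f \<theta>)\<bar> \<le> e"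
    if n: "n \<ge> n0" and \<theta>: "\<theta> \<in> X_simplex" for n \<theta>
  proof -
    let ?w = "\<lambda>z. \<Prod>k=1..n. \<theta> $ z k"
    have \<theta>': "\<theta> $ x \<ge> 0" "(\<Sum>x\<in>UNIV. \<theta> $ x) = 1" for x
      using \<theta> by (auto simp: X_simplex_def)
    have "\<bar>(\<Sum>z\<in>tuples n. ?w z * h ((1 / real n) * (\<Sum>k=1..n. f (z k)))) - h (S f \<theta>)\<bar> \<le> e"
    proof (rule law[OF n])
      show "\<forall>z\<in>tuples n. ?w z \<ge> 0" using \<theta>'(1) by (simp add: prod_nonneg)
      show "sum ?w (tuples n) = 1" using sum_tuples_prod[of "\<lambda>_ x. \<theta> $ x" n] \<theta>'(2) by simp
      show "S f \<theta> \<in> {(INF x. f x)..(SUP x. f x)}" by (rule S_in_range_interval[OF \<theta>])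
      show "\<forall>k\<in>{1..n}. \<forall>z\<in>tuples n. f (z k) \<in> {(INF x. f x)..(SUP x. f x)}"
        using f_in_range_interval by blast
      have "(\<Sum>x\<in>UNIV. \<theta> $ x * (f x - S f \<theta>)) = S f \<theta> - (\<Sum>x\<in>UNIV. \<theta> $ x) * S f \<theta>"
        by (simp add: S_def[of f \<theta>] right_diff_distrib sum_subtractf sum_distrib_right mult_ac)
      then have "(\<Sum>x\<in>UNIV. \<theta> $ x * (f x - S f \<theta>)) = 0" using \<theta>'(2) by simp
      then show "\<forall>k\<in>{1..n}. \<forall>l\<in>{1..n}. k \<noteq> l \<longrightarrow>
          (\<Sum>z\<in>tuples n. ?w z * ((f (z k) - S f \<theta>) * (f (z l) - S f \<theta>))) \<le> 0"
        using tuples_uncorrelated[where g = "\<lambda>x. f x - S f \<theta>"] by fastforce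
    qed
    then show ?thesis by (simp add: Mn_def sample_mean_def mult.commute)
  qed
  then show ?thesis using n0 by blast
qed

lemma X_simplex_nonempty: "(X_simplex :: (real ^ 'x::finite) set) \<noteq> {}"
proof -
  have "(\<chi> x. 1 / real CARD('x)) \<in> (X_simplex :: (real ^ 'x) set)"
    by (simp add: X_simplex_def)
  then show ?thesis by blast
qed

lemma continuous_on_Mn: "continuous_on T (Mn n u :: real ^ 'x::finite \<Rightarrow> real)"
  unfolding Mn_def by (intro continuous_intros)

lemma continuous_on_h_S:
  fixes f :: "'x::finite \<Rightarrow> real"
  assumes "continuous_on {(INF x. f x)..(SUP x. f x)} h"
  shows "continuous_on X_simplex (\<lambda>\<theta>. h (S f \<theta>))"
proof (rule continuous_on_compose2[OF assms])
  show "continuous_on X_simplex (S f)" unfolding S_def by (intro continuous_intros)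
qed (use S_in_range_interval in blast)

lemma sample_mean_tendsto_representing:
  fixes f :: "'x::finite \<Rightarrow> real"
  assumes R: "representing_lower_prevision P R"
    and h: "continuous_on {(INF x. f x)..(SUP x. f x)} h"
  shows "(\<lambda>n. sample_mean_distribution P f n h) \<longlonglongrightarrow> R (\<lambda>\<theta>. h (S f \<theta>))"
proof (rule LIMSEQ_I)
  fix r :: real assume "r > 0"
  then have "r / 2 > 0" by simp
  from Mn_sample_mean_uniform[OF h this]
  obtain n0 where n0: "n0 \<ge> 1" and close: "\<And>n \<theta>. n \<ge> n0 \<Longrightarrow> \<theta> \<in> X_simplex \<Longrightarrow>
      \<bar>Mn n (h \<circ> sample_mean n f) \<theta> - h (S f \<theta>)\<bar> \<le> r / 2"
    by blast
  have coh: "coherent_lower_prevision X_simplex continuous_on_simplex R"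
    and rep: "\<And>n u. n \<ge> 1 \<Longrightarrow> P n u = R (Mn n u)"
    using R unfolding representing_lower_prevision_def gambles_tuples by blast+
  have "norm (sample_mean_distribution P f n h - R (\<lambda>\<theta>. h (S f \<theta>))) < r" if n: "n \<ge> n0" for n
  proof -
    have "\<bar>R (Mn n (h \<circ> sample_mean n f)) - R (\<lambda>\<theta>. h (S f \<theta>))\<bar> \<le> r / 2"
      by (rule coherent_lipschitz[OF coh X_simplex_nonempty])
        (use close[OF n] in \<open>auto simp: continuous_on_simplex_def
          intro!: continuous_on_Mn continuous_on_h_S[OF h] continuous_on_diff\<close>)
    then show ?thesis
      using rep n n0 \<open>r > 0\<close> by (simp add: sample_mean_distribution_def)
  qed
  then show "\<exists>n0. \<forall>n\<ge>n0. norm (sample_mean_distribution P f n h - R (\<lambda>\<theta>. h (S f \<theta>))) < r" by blast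
qed

section \<open>Sampling without replacement\<close>

lemma permutation_sum_transpose:
  fixes c :: "(nat \<Rightarrow> nat) \<Rightarrow> real"
  assumes "i \<in> A" "j \<in> A"
  shows "(\<Sum>\<pi> | \<pi> permutes A. c \<pi>) = (\<Sum>\<pi> | \<pi> permutes A. c (\<pi> \<circ> Transposition.transpose i j))"
  by (rule sum_permutations_compose_right[OF permutes_swap_id[OF assms]])

text \<open>
  Fix \<open>k\<close>. By symmetry the correlation with \<open>l\<close> is the same number for all \<open>l \<noteq> k\<close>. Summed over
  all \<open>l\<close>, including \<open>l = k\<close>, the correlations vanish because a permutation does not change the
  sum of the centred values; since the term with \<open>l = k\<close> is a sum of squares, the others are not
  positive.
\<close>
lemma permutation_nonpositively_correlated:
  fixes g :: "nat \<Rightarrow> real"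
  assumes kl: "k \<in> {1..N}" "l \<in> {1..N}" "k \<noteq> l" and g: "(\<Sum>i=1..N. g i) = 0"
  shows "(\<Sum>\<pi> | \<pi> permutes {1..N}. g (\<pi> k) * g (\<pi> l)) \<le> 0"
proof -
  let ?c = "\<lambda>l. \<Sum>\<pi> | \<pi> permutes {1..N}. g (\<pi> k) * g (\<pi> l)"
  have sym: "?c j = ?c l" if "j \<in> {1..N} - {k}" for j
  proof -
    have "?c j = (\<Sum>\<pi> | \<pi> permutes {1..N}. g ((\<pi> \<circ> Transposition.transpose j l) k)
        * g ((\<pi> \<circ> Transposition.transpose j l) j))"
      by (rule permutation_sum_transpose) (use that kl in auto)
    moreover have "Transposition.transpose j l k = k"
      using that kl by (auto simp: transpose_def)
    ultimately show ?thesis by simp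
  qed
  have "(\<Sum>j=1..N. ?c j) = (\<Sum>\<pi> | \<pi> permutes {1..N}. g (\<pi> k) * (\<Sum>j=1..N. g (\<pi> j)))"
    by (subst sum.swap) (simp add: sum_distrib_left)
  also have "\<dots> = 0"
  proof (rule sum.neutral, rule ballI)
    fix \<pi> assume "\<pi> \<in> {\<pi>. \<pi> permutes {1..N}}"
    then have "(\<Sum>j=1..N. g (\<pi> j)) = (\<Sum>j=1..N. g j)"
      using sum.permute[of \<pi> "{1..N}" g] by (simp add: comp_def)
    then show "g (\<pi> k) * (\<Sum>j=1..N. g (\<pi> j)) = 0" using g by simp
  qed
  finally have "0 = (\<Sum>j=1..N. ?c j)" by simp
  also have "\<dots> = ?c k + (\<Sum>j\<in>{1..N} - {k}. ?c j)"
    by (rule sum.remove) (use kl in auto)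
  also have "(\<Sum>j\<in>{1..N} - {k}. ?c j) = real (card ({1..N} - {k})) * ?c l"
    using sym by simp
  finally have "real (card ({1..N} - {k})) * ?c l = - ?c k" by linarith
  also have "\<dots> \<le> 0" by (simp add: sum_nonneg)
  finally have "real (card ({1..N} - {k})) * ?c l \<le> 0" .
  moreover have "real (card ({1..N} - {k})) > 0" using kl by (auto simp: card_gt_0_iff)
  ultimately show ?thesis unfolding mult_le_0_iff by linarith
qed

lemma permutation_sample_mean_uniform:
  fixes f :: "'x::finite \<Rightarrow> real"
    and h :: "real \<Rightarrow> real"
  assumes "continuous_on {(INF x. f x)..(SUP x. f x)} h" and "e > 0"
  shows "\<exists>n0\<ge>1. \<forall>n\<ge>n0. \<forall>N\<ge>n. \<forall>z :: nat \<Rightarrow> 'x.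
    \<bar>(\<Sum>\<pi> | \<pi> permutes {1..N}. (1 / fact N) * h (sample_mean n f (z \<circ> \<pi>))) - h (sample_mean N f z)\<bar>
      \<le> e"
proof (rule weak_law_uniform[OF assms, where 'a = "nat \<Rightarrow> nat"], goal_cases)
  case (1 n0)
  note n0 = 1(1) and law = 1(2)
  have "\<bar>(\<Sum>\<pi> | \<pi> permutes {1..N}. (1 / fact N) * h (sample_mean n f (z \<circ> \<pi>)))
      - h (sample_mean N f z)\<bar> \<le> e"
    if n: "n \<ge> n0" and N: "N \<ge> n" for n N and z :: "nat \<Rightarrow> 'x"
  proof -
    let ?\<mu> = "sample_mean N f z"
    let ?perms = "{\<pi>. \<pi> permutes {1..N}}"
    have "\<bar>(\<Sum>\<pi>\<in>?perms. (1 / fact N) * h ((1 / real n) * (\<Sum>k=1..n. f (z (\<pi> k))))) - h ?\<mu>\<bar> \<le> e"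
    proof (rule law[OF n])
      show "\<forall>\<pi>\<in>?perms. (0::real) \<le> 1 / fact N" by simp
      show "(\<Sum>\<pi>\<in>?perms. 1 / fact N) = (1::real)" by (simp add: card_permutations)
      show "?\<mu> \<in> {(INF x. f x)..(SUP x. f x)}"
        unfolding sample_mean_def
        by (rule average_in_interval) (use f_in_range_interval n0 n N in auto)
      show "\<forall>k\<in>{1..n}. \<forall>\<pi>\<in>?perms. f (z (\<pi> k)) \<in> {(INF x. f x)..(SUP x. f x)}"
        using f_in_range_interval by blast
      have centred: "(\<Sum>i=1..N. f (z i) - ?\<mu>) = 0"
        using n0 n N by (simp add: sum_subtractf sample_mean_def)
      show "\<forall>k\<in>{1..n}. \<forall>l\<in>{1..n}. k \<noteq> l \<longrightarrow>
          (\<Sum>\<pi>\<in>?perms. (1 / fact N) * ((f (z (\<pi> k)) - ?\<mu>) * (f (z (\<pi> l)) - ?\<mu>))) \<le> 0"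
      proof (intro ballI impI)
        fix k l assume "k \<in> {1..n}" "l \<in> {1..n}" "k \<noteq> l"
        then have "(\<Sum>\<pi>\<in>?perms. (f (z (\<pi> k)) - ?\<mu>) * (f (z (\<pi> l)) - ?\<mu>)) \<le> 0"
          using N by (intro permutation_nonpositively_correlated[OF _ _ _ centred]) auto
        then show "(\<Sum>\<pi>\<in>?perms. (1 / fact N) * ((f (z (\<pi> k)) - ?\<mu>) * (f (z (\<pi> l)) - ?\<mu>))) \<le> 0"
          unfolding sum_distrib_left[symmetric] by (simp add: divide_le_0_iff)
      qed
    qed
    then show ?thesis by (simp add: sample_mean_def)
  qed
  then show ?thesis using n0 by blast
qed

lemma sample_mean_restrict: "sample_mean n f (restrict z {1..n}) = sample_mean n f z"
  unfolding sample_mean_def by simp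

lemma sample_mean_convergent:
  fixes P :: "nat \<Rightarrow> ((nat \<Rightarrow> 'x::finite) \<Rightarrow> real) \<Rightarrow> real"
  assumes P: "exchangeable_sequence P" and h: "continuous_on {(INF x. f x)..(SUP x. f x)} h"
  shows "convergent (\<lambda>n. sample_mean_distribution P f n h)"
proof -
  let ?Q = "\<lambda>n. sample_mean_distribution P f n h"
  have coh: "coherent_lower_prevision (tuples n) UNIV (P n)" and ex: "exchangeable n (P n)"
    if "n \<ge> 1" for n
    using P that unfolding exchangeable_sequence_def gambles_tuples by blast+
  have tc: "P n u = P (n + k) (\<lambda>z. u (restrict z {1..n}))" if "n \<ge> 1" for n k u
    using P that unfolding exchangeable_sequence_def time_consistent_def gambles_tuples by blast
  have "Cauchy ?Q"
  proof (rule CauchyI')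
    fix e :: real assume "e > 0"
    then have "e / 2 > 0" by simp
    from permutation_sample_mean_uniform[OF h this]
    obtain n0 where n0: "n0 \<ge> 1" and close: "\<And>n N z. n \<ge> n0 \<Longrightarrow> N \<ge> n \<Longrightarrow>
      \<bar>(\<Sum>\<pi> | \<pi> permutes {1..N}. (1 / fact N) * h (sample_mean n f (z \<circ> \<pi>)))
        - h (sample_mean N f z)\<bar> \<le> e / 2"
      by blast
    have "dist (?Q n) (?Q N) < e" if n: "n \<ge> n0" and N: "N > n" for n N
    proof -
      have "N \<ge> 1" using N by simp
      have "?Q n = P N (\<lambda>z. h (sample_mean n f z))"
        using tc[of n "h \<circ> sample_mean n f" "N - n"] n0 n N
        unfolding sample_mean_distribution_def comp_def sample_mean_restrict by simp
      also have "\<dots> = P N (\<lambda>z. \<Sum>\<pi> | \<pi> permutes {1..N}. (1 / fact N) * h (sample_mean n f (z \<circ> \<pi>)))"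
        by (rule exchangeable_average[OF coh[OF \<open>N \<ge> 1\<close>] ex[OF \<open>N \<ge> 1\<close>],
            where u = "\<lambda>z. h (sample_mean n f z)", symmetric])
      finally have Qn: "?Q n = \<dots>" .
      have "\<bar>?Q n - ?Q N\<bar> \<le> e / 2"
        unfolding Qn unfolding sample_mean_distribution_def
        by (rule coherent_lipschitz[OF coh[OF \<open>N \<ge> 1\<close>] tuples_nonempty UNIV_I UNIV_I UNIV_I UNIV_I])
          (unfold comp_def[of h], rule close[OF n less_imp_le[OF N]])
      then show ?thesis using \<open>e > 0\<close> by (simp add: dist_real_def)
    qed
    then show "\<exists>M. \<forall>m\<ge>M. \<forall>n>m. dist (?Q m) (?Q n) < e" by blast
  qed
  then show ?thesis by (rule Cauchy_convergent)
qed

section \<open>The limit law\<close>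

theorem mainTheorem4:
  fixes P :: "nat \<Rightarrow> ((nat \<Rightarrow> 'x::finite) \<Rightarrow> real) \<Rightarrow> real"
    and f :: "'x \<Rightarrow> real"
  assumes "exchangeable_sequence P"
  shows "(\<forall>R. representing_lower_prevision P R \<longrightarrow>
            (\<forall>h\<in>gambles {(INF x. f x)..(SUP x. f x)}.
               continuous_on {(INF x. f x)..(SUP x. f x)} h \<longrightarrow>
               (\<lambda>n. sample_mean_distribution P f n h) \<longlonglongrightarrow> R (\<lambda>\<theta>. h (S f \<theta>)))) \<and>
         converges_in_distribution {(INF x. f x)..(SUP x. f x)} (sample_mean_distribution P f)"
  unfolding converges_in_distribution_def
  by (intro conjI allI impI ballI sample_mean_tendsto_representing sample_mean_convergent[OF assms])

end
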